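(* The solutions of the equation $$(x+y)^y = (x-y)^x$$ in positive integers $x, y$ with $x > y$ are exactly the pairs of one of the following two forms: $$x = m(2m-1)^{m-1}, \qquad y = (m-1)(2m-1)^{m-1},$$ where $m \ge 2$ is an integer, or $$x = (4n^2+1)\cdot\frac{(2n)^{4n^2-1}}{2}, \qquad y = (4n^2-1)\cdot\frac{(2n)^{4n^2-1}}{2},$$ where $n \ge 1$ is an integer. *)

theory Defs
  imports Main
begin

end

theory Submission
  imports Defs
begin

text \<open>
  Write \<open>x = d X\<close>, \<open>y = d Y\<close> with \<open>d = gcd x y\<close>. Taking \<open>d\<close>-th roots gives \<open>(x + y)\<^sup>Y = (x - y)\<^sup>X\<close>
  with coprime exponents, so \<open>x + y = t\<^sup>X\<close> and \<open>x - y = t\<^sup>Y\<close> for some \<open>t\<close>. Dividing,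
  \<open>X + Y = t\<^bsup>X-Y\<^esup> (X - Y)\<close>; hence \<open>X - Y\<close> divides both \<open>X + Y\<close> and \<open>X - Y\<close>, whose gcd divides 2.
  The cases \<open>X - Y = 1\<close> and \<open>X - Y = 2\<close> are the two families.
\<close>

text \<open>Bezout gives \<open>p * u = q * v + 1\<close>, and \<open>t\<close> is the quotient of
  \<open>a ^ u\<close> by \<open>b ^ v\<close>: its \<open>p\<close>-th power is \<open>a\<close>
  and its \<open>q\<close>-th power is \<open>b\<close>. It is an integer because divisibility of
  \<open>p\<close>-th powers passes to their bases.\<close>

lemma common_base_of_coprime_powers:
  fixes a b p q :: nat
  assumes "coprime p q" "p > 0" "q > 0" "b > 0" and eq: "a ^ q = b ^ p"
  obtains t where "a = t ^ p" "b = t ^ q"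
proof -
  obtain u v where uv: "p * u = q * v + 1"
    using bezout_nat[of p q] assms by auto
  have "(b ^ v) ^ p = (b ^ p) ^ v"
    by (metis power_mult mult.commute)
  also have "\<dots> = a ^ (q * v)"
    by (simp add: eq[symmetric] power_mult)
  finally have bvp: "(b ^ v) ^ p = a ^ (q * v)" .
  have aup: "(a ^ u) ^ p = a * a ^ (q * v)"
    using uv by (metis Suc_eq_plus1 mult.commute power_Suc power_mult)
  have "(b ^ v) ^ p dvd (a ^ u) ^ p"
    by (simp add: bvp aup)
  then have "b ^ v dvd a ^ u"
    using \<open>p > 0\<close> pow_divides_pow_iff by blast
  then obtain t where t: "a ^ u = b ^ v * t" ..
  have pos: "a > 0"
    using eq \<open>b > 0\<close> \<open>q > 0\<close> by (metis gr0I power_eq_0_iff)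
  have "a ^ (q * v) * t ^ p = a ^ (q * v) * a"
    using aup by (simp only: t power_mult_distrib bvp mult.commute)
  then have "a = t ^ p"
    using pos by simp
  have "(a ^ u) ^ q = b ^ (q * v) * b"
    by (metis uv eq Suc_eq_plus1 mult.commute power_Suc power_mult)
  then have "b ^ (q * v) * t ^ q = b ^ (q * v) * b"
    by (simp add: t power_mult_distrib power_mult[symmetric] mult.commute)
  then have "b = t ^ q"
    using \<open>b > 0\<close> by simp
  with \<open>a = t ^ p\<close> show thesis by (rule that)
qed

lemma coprime_add_eq_mult_diff_cases:
  fixes X Y c :: nat
  assumes "coprime X Y" "Y < X" "X + Y = c * (X - Y)"
  shows "X - Y = 1 \<or> X - Y = 2"
proof -
  \<comment> \<open>Sum and difference of \<open>X + Y\<close> and \<open>X - Y\<close> are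
    \<open>2 * X\<close> and \<open>2 * Y\<close>, whose gcd is 2 by coprimality.\<close>
  have "X - Y dvd (X + Y) + (X - Y)" "X - Y dvd (X + Y) - (X - Y)"
    by (simp_all add: assms)
  moreover have "(X + Y) + (X - Y) = 2 * X" "(X + Y) - (X - Y) = 2 * Y"
    using \<open>Y < X\<close> by auto
  ultimately have "X - Y dvd gcd (2 * X) (2 * Y)" by simp
  also have "gcd (2 * X) (2 * Y) = 2"
    using assms(1) by (metis coprime_imp_gcd_eq_1 gcd_mult_distrib_nat mult.right_neutral)
  finally have "X - Y dvd 2" .
  then show ?thesis
    using \<open>Y < X\<close> dvd_imp_le[of "X - Y" 2] by linarith
qed

lemma solution_parametrization:
  fixes x y :: nat
  assumes "y > 0" "y < x" and eq: "(x + y) ^ y = (x - y) ^ x"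
  obtains d X Y t where "x = d * X" "y = d * Y" "coprime X Y" "0 < Y" "Y < X" "t > 0"
    "d * (X - Y) = t ^ Y" "X + Y = t ^ (X - Y) * (X - Y)"
proof -
  define d where "d = gcd x y"
  obtain X Y where XY: "x = X * d" "y = Y * d" "coprime X Y"
    using gcd_coprime_exists[of x y] assms unfolding d_def by auto
  have pos: "d > 0" "Y > 0" "Y < X"
    using assms XY by auto
  have "((x + y) ^ Y) ^ d = ((x - y) ^ X) ^ d"
    using eq XY by (simp add: power_mult)
  then have "(x + y) ^ Y = (x - y) ^ X"
    using \<open>d > 0\<close> power_eq_iff_eq_base by blast
  \<comment> \<open>The instantiation follows the order \<open>p\<close>, \<open>q\<close>,
    \<open>b\<close>, \<open>a\<close>, so \<open>x + y\<close> takes the role of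
    \<open>a\<close>.\<close>
  then obtain t where t: "x + y = t ^ X" "x - y = t ^ Y"
    using common_base_of_coprime_powers[of X Y "x - y" "x + y"] XY pos \<open>y < x\<close> by auto
  have "t > 0"
    using t(2) \<open>y < x\<close> pos by (metis gr0I power_eq_0_iff zero_less_diff)
  have diff: "d * (X - Y) = t ^ Y"
    using t(2) XY by (simp add: diff_mult_distrib2 mult.commute)
  \<comment> \<open>Splitting \<open>t ^ X\<close> exposes the factor \<open>t ^ Y\<close>, which
    equals \<open>d * (X - Y)\<close>; then \<open>d\<close> cancels.\<close>
  have "d * (X + Y) = t ^ (X - Y) * t ^ Y"
    using t(1) XY pos by (simp add: algebra_simps flip: power_add)
  then have "d * (X + Y) = d * (t ^ (X - Y) * (X - Y))"
    unfolding diff[symmetric] by (simp only: ac_simps)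
  then have "X + Y = t ^ (X - Y) * (X - Y)"
    using \<open>d > 0\<close> by simp
  then show thesis
    using that[of d X Y t] XY pos \<open>t > 0\<close> diff by (simp add: mult.commute)
qed

text \<open>Both sides equal \<open>t ^ (X * Y * d)\<close>. Checking a family thus reduces to
  computing \<open>x + y\<close> and \<open>x - y\<close>.\<close>

lemma power_eq_of_common_base:
  fixes x y d X Y t :: nat
  assumes "x = X * d" "y = Y * d" "x + y = t ^ X" "x - y = t ^ Y"
  shows "(x + y) ^ y = (x - y) ^ x"
  unfolding assms(3,4) unfolding assms(1,2) by (simp add: ac_simps flip: power_mult)

text \<open>Here \<open>X = m\<close>, \<open>Y = m - 1\<close>, \<open>t = 2 * m - 1\<close> and
  \<open>d = t ^ (m - 1)\<close>.\<close>

lemma first_family_solves: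
  fixes m :: nat
  assumes "m \<ge> 2"
    and x: "x = m * (2 * m - 1) ^ (m - 1)" and y: "y = (m - 1) * (2 * m - 1) ^ (m - 1)"
  shows "0 < y \<and> y < x \<and> (x + y) ^ y = (x - y) ^ x"
proof -
  define t where "t = 2 * m - 1"
  have t: "m + (m - 1) = t" "m - (m - 1) = 1" and "t > 0"
    using \<open>m \<ge> 2\<close> by (auto simp: t_def)
  have "x + y = t * t ^ (m - 1)"
    unfolding x y t_def[symmetric] by (metis t(1) add_mult_distrib)
  then have "x + y = t ^ m"
    using \<open>m \<ge> 2\<close> power_eq_if[of t m] by simp
  moreover have "x - y = t ^ (m - 1)"
    unfolding x y t_def[symmetric] by (metis t(2) diff_mult_distrib mult_1)
  ultimately show ?thesis
    using power_eq_of_common_base[OF x y] \<open>m \<ge> 2\<close> \<open>t > 0\<close>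
    by (simp add: x y flip: t_def)
qed

text \<open>Here \<open>t = 2 * n\<close>, \<open>Y = t\<^sup>2 - 1\<close>,
  \<open>X = Y + 2\<close> and \<open>2 * d = t ^ Y\<close>.\<close>

lemma second_family_solves:
  fixes n :: nat
  assumes "n \<ge> 1"
    and x: "x = (4 * n\<^sup>2 + 1) * ((2 * n) ^ (4 * n\<^sup>2 - 1) div 2)"
    and y: "y = (4 * n\<^sup>2 - 1) * ((2 * n) ^ (4 * n\<^sup>2 - 1) div 2)"
  shows "0 < y \<and> y < x \<and> (x + y) ^ y = (x - y) ^ x"
proof -
  define Y where "Y = 4 * n\<^sup>2 - 1"
  define d where "d = (2 * n) ^ Y div 2"
  have "n\<^sup>2 \<ge> 1"
    using \<open>n \<ge> 1\<close> by simp
  then have Y: "4 * n\<^sup>2 = Y + 1" "Y > 0"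
    unfolding Y_def by linarith+
  \<comment> \<open>The halving is exact: a positive power of \<open>2 * n\<close> is even.\<close>
  have d: "2 * d = (2 * n) ^ Y"
    using \<open>Y > 0\<close> by (simp add: d_def)
  then have "d > 0"
    using \<open>n \<ge> 1\<close> by (metis gr0I mult_0_right mult_eq_0_iff not_one_le_zero power_eq_0_iff zero_neq_numeral)
  have x': "x = (Y + 2) * d" and y': "y = Y * d"
    unfolding x y Y_def[symmetric] d_def[symmetric] by (simp_all add: Y)
  have "x + y = (Y + 1) * (2 * d)"
    by (simp add: x' y' algebra_simps)
  also have "\<dots> = (2 * n)\<^sup>2 * (2 * n) ^ Y"
    unfolding d by (simp only: power_mult_distrib[of 2 n 2] Y(1)[symmetric]) simp
  finally have "x + y = (2 * n) ^ (Y + 2)"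
    by (simp only: power_add mult.commute)
  moreover have "x - y = (2 * n) ^ Y"
    unfolding d[symmetric] by (simp add: x' y' algebra_simps)
  ultimately have "(x + y) ^ y = (x - y) ^ x"
    using power_eq_of_common_base[OF x' y'] by blast
  then show ?thesis
    using \<open>Y > 0\<close> \<open>d > 0\<close> x' y' by simp
qed

theorem mainTheorem14:
  fixes x y :: nat
  shows "(x > 0 \<and> y > 0 \<and> x > y \<and> (x + y) ^ y = (x - y) ^ x) \<longleftrightarrow>
    (\<exists>m::nat. m \<ge> 2 \<and>
        x = m * (2 * m - 1) ^ (m - 1) \<and>
        y = (m - 1) * (2 * m - 1) ^ (m - 1)) \<or>
    (\<exists>n::nat. n \<ge> 1 \<and>
        x = (4 * n\<^sup>2 + 1) * ((2 * n) ^ (4 * n\<^sup>2 - 1) div 2) \<and>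
        y = (4 * n\<^sup>2 - 1) * ((2 * n) ^ (4 * n\<^sup>2 - 1) div 2))"
    (is "?sol \<longleftrightarrow> ?first \<or> ?second")
proof
  assume ?sol
  then obtain d X Y t where xy: "x = d * X" "y = d * Y"
    and XY: "coprime X Y" "0 < Y" "Y < X" and "t > 0"
    and d: "d * (X - Y) = t ^ Y" and quot: "X + Y = t ^ (X - Y) * (X - Y)"
    using solution_parametrization by blast
  consider "X - Y = 1" | "X - Y = 2"
    using coprime_add_eq_mult_diff_cases[OF XY(1,3) quot] by blast
  then show "?first \<or> ?second"
  proof cases
    case 1
    \<comment> \<open>With difference 1, \<open>quot\<close> reads \<open>X + Y = t\<close>; the
      witness for \<open>m\<close> is \<open>X\<close>.\<close>
    then have "Y = X - 1" "t = 2 * X - 1" "d = t ^ Y" "X \<ge> 2"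
      using d quot XY by auto
    then have ?first
      using xy by (intro exI[of _ X]) (simp add: mult.commute)
    then show ?thesis ..
  next
    case 2
    then have X: "X = Y + 2" using XY by simp
    have t: "Y + 1 = t\<^sup>2"
      using quot 2 X by simp
    \<comment> \<open>If \<open>Y\<close> were even, so would be \<open>X = Y + 2\<close>, against
      coprimality.\<close>
    have "odd Y"
      using XY(1) X by (metis coprime_common_divisor_nat dvd_add_triv_right_iff even_add
          dvd_refl numeral_eq_one_iff semiring_norm(85))
    then have "even t"
      using t by (metis even_add odd_one even_power)
    then obtain n where n: "t = 2 * n" ..
    have "n \<ge> 1" using n \<open>t > 0\<close> by simp
    have Y: "Y = 4 * n\<^sup>2 - 1" and X': "X = 4 * n\<^sup>2 + 1"
      using t X n by (simp_all add: power_mult_distrib)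
    \<comment> \<open>From \<open>d * 2 = t ^ Y\<close>, so again nothing is lost in the
      division.\<close>
    have "d = (2 * n) ^ Y div 2"
      using d 2 n by (metis nonzero_mult_div_cancel_right zero_neq_numeral)
    then have ?second
      using xy Y X' \<open>n \<ge> 1\<close> by (intro exI[of _ n]) (simp add: mult.commute)
    then show ?thesis ..
  qed
next
  assume "?first \<or> ?second"
  then have "0 < y \<and> y < x \<and> (x + y) ^ y = (x - y) ^ x"
    using first_family_solves second_family_solves by blast
  then show ?sol by auto
qed

end
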